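(* Let $n$ be a positive integer, $p\in(0,1)$, and let $t$ be a positive integer with $np<t<n$. Suppose that $f\in\mathcal{F}_{sic}$ is such that $V_n(f,t)\le V_n(f',t)$ for all $f'\in\mathcal{F}_{sic}$. Then there exists $g\in\mathcal{F}_{sic}$ such that $V_n(g,t)=V_n(f,t)$ and $g(x)=e^{hx}$ for all $x\ge0$, for some positive constant $h$.
   Context: A function $f:[0,+\infty)\to[0,+\infty)$ is sub-multiplicative if $f(x+y)\le f(x)f(y)$ for all $x,y\ge0$. $\mathcal{F}_{sic}$ denotes the set of all functions $f:[0,+\infty)\to[0,+\infty)$ (not identically zero) that are sub-multiplicative, increasing (in the sense of nondecreasing) and convex. For $f\in\mathcal{F}_{sic}$, $$V_n(f,t):=\frac{1}{f(t)}\left\{(1-p)f(0)+pf(1)\right\}^n .$$ *)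

theory Defs
  imports "HOL-Analysis.Analysis"
begin

(* A function from [0,oo) to [0,oo) is represented by any f :: real => real that maps
   {0..} into {0..}; the values of f at negative arguments are irrelevant throughout. *)

definition submultiplicative :: "(real \<Rightarrow> real) \<Rightarrow> bool" where
  "submultiplicative f \<longleftrightarrow> (\<forall>x\<ge>0. \<forall>y\<ge>0. f (x + y) \<le> f x * f y)"

definition F_sic :: "(real \<Rightarrow> real) set" where
  "F_sic = {f. f \<in> {0..} \<rightarrow> {0..} \<and> (\<exists>x\<ge>0. f x \<noteq> 0) \<and>
               submultiplicative f \<and> mono_on {0..} f \<and> convex_on {0..} f}"

(* The denominator f t is nonzero for f in F_sic and t >= 0: if f t = 0, then f vanishes
   on {t..} by submultiplicativity, hence on all of {0..} by monotonicity. *)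
definition V :: "real \<Rightarrow> nat \<Rightarrow> (real \<Rightarrow> real) \<Rightarrow> real \<Rightarrow> real" where
  "V p n f t = 1 / f t * ((1 - p) * f 0 + p * f 1) ^ n"

end

theory Submission
  imports Defs
begin

text \<open>
  The value of \<open>V p n\<close> at \<open>f\<close> depends on \<open>f 0\<close>, \<open>f 1\<close> and \<open>f t\<close> only. Submultiplicativity
  gives \<open>1 \<le> f 0\<close> and, as \<open>t\<close> is a positive integer, \<open>f t \<le> f 1 ^ t\<close>. The exponential
  \<open>g x = f 1 powr x\<close> turns both estimates into equalities while keeping the value at \<open>1\<close>,
  so \<open>V p n g t \<le> V p n f t\<close>, and minimality of \<open>f\<close> makes this an equality.

  The growth rate \<open>ln (f 1)\<close> has to be positive, so the case \<open>f 1 = 1\<close> must be excluded. There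
  \<open>V p n f t \<ge> 1\<close>, which is the value at the constant function \<open>1\<close>. But
  \<open>h \<mapsto> V p n (\<lambda>x. exp (h * x)) t\<close> has derivative \<open>n * p - t < 0\<close> at \<open>h = 0\<close>, so a
  small positive rate does strictly better than \<open>1\<close>, and \<open>f\<close> would not be a minimiser.
\<close>

lemma exp_in_F_sic:
  assumes "0 \<le> h"
  shows "(\<lambda>x. exp (h * x)) \<in> F_sic"
proof -
  have "convex_on {0..} (\<lambda>x. exp (h * x))"
  proof (rule f''_ge0_imp_convex)
    show "((\<lambda>x. exp (h * x)) has_real_derivative h * exp (h * x)) (at x)" for x
      by (auto intro!: derivative_eq_intros)
    show "((\<lambda>x. h * exp (h * x)) has_real_derivative h * h * exp (h * x)) (at x)" for x
      by (auto intro!: derivative_eq_intros)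
  qed auto
  moreover have "mono_on {0..} (\<lambda>x. exp (h * x))"
    using assms by (auto intro!: mono_onI mult_left_mono)
  ultimately show ?thesis
    by (auto simp: F_sic_def submultiplicative_def distrib_left exp_add)
qed

text \<open>
  From \<open>f x \<le> f x * f 0\<close> at a point with \<open>f x \<noteq> 0\<close> one gets \<open>1 \<le> f 0\<close>; monotonicity
  spreads the bound to the whole half-line.
\<close>

lemma F_sic_ge_1:
  assumes "f \<in> F_sic" and "0 \<le> x"
  shows "1 \<le> f x"
proof -
  obtain y where y: "0 \<le> y" "f y \<noteq> 0"
    using assms by (auto simp: F_sic_def)
  have "0 < f y"
    using assms y by (force simp: F_sic_def Pi_iff less_le)
  moreover have "f (y + 0) \<le> f y * f 0"
    using assms y unfolding F_sic_def submultiplicative_def by blast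
  ultimately have "1 \<le> f 0"
    by simp
  also have "f 0 \<le> f x"
    using assms by (auto simp: F_sic_def dest: mono_onD)
  finally show ?thesis .
qed

text \<open>
  Since \<open>f 0\<close> may exceed \<open>1\<close>, the estimate can fail at exponent \<open>0\<close>; the induction
  therefore starts at \<open>1\<close>.
\<close>

lemma submultiplicative_le_power:
  assumes "submultiplicative f" and "0 \<le> f 1" and "0 < t"
  shows "f (real t) \<le> f 1 ^ t"
  using \<open>0 < t\<close>
proof (induction t rule: nat_induct_non_zero)
  case (Suc k)
  have "f (1 + real k) \<le> f 1 * f (real k)"
    using assms(1) unfolding submultiplicative_def by simp
  also have "\<dots> \<le> f 1 * f 1 ^ k"
    using Suc.IH assms(2) by (rule mult_left_mono)
  finally show ?case
    by simp
qed simp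

lemma V_exp:
  "V p n (\<lambda>x. exp (h * x)) (real t) = (1 - p + p * exp h) ^ n / exp h ^ t"
  by (simp add: V_def exp_of_nat2_mult)

lemma V_lower_bound:
  assumes "f \<in> F_sic" and "0 < p" and "p < 1" and "0 < t"
  shows "(1 - p + p * f 1) ^ n / f 1 ^ t \<le> V p n f (real t)"
proof -
  have ge1: "1 \<le> f 0" "1 \<le> f 1" "1 \<le> f (real t)"
    using assms by (simp_all add: F_sic_ge_1)
  have le: "f (real t) \<le> f 1 ^ t"
    using assms ge1 by (intro submultiplicative_le_power) (auto simp: F_sic_def)
  have "1 - p + p * f 1 \<le> (1 - p) * f 0 + p * f 1"
    using assms ge1 by simp
  then have "(1 - p + p * f 1) ^ n \<le> ((1 - p) * f 0 + p * f 1) ^ n"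
    using assms ge1 by (intro power_mono) auto
  with le have "(1 - p + p * f 1) ^ n / f 1 ^ t \<le> ((1 - p) * f 0 + p * f 1) ^ n / f (real t)"
    using assms ge1 by (intro frac_le) auto
  then show ?thesis
    by (simp add: V_def)
qed

text \<open>
  The left-hand side equals \<open>1\<close> at \<open>h = 0\<close>, and its derivative there is the drift
  \<open>n * p - t\<close>, which is negative.
\<close>

lemma exists_exp_V_less_1:
  fixes p :: real and n t :: nat
  assumes "real n * p < real t"
  shows "\<exists>h>0. V p n (\<lambda>x. exp (h * x)) (real t) < 1"
proof -
  let ?\<phi> = "\<lambda>h. (1 - p + p * exp h) ^ n / exp h ^ t"
  have "(?\<phi> has_real_derivative real n * p - real t) (at 0)"
    by (auto intro!: derivative_eq_intros)
  from DERIV_neg_dec_right[OF this] assms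
  obtain d where d: "0 < d" "\<And>h. 0 < h \<Longrightarrow> h < d \<Longrightarrow> ?\<phi> (0 + h) < ?\<phi> 0"
    by auto
  then have "?\<phi> (d / 2) < 1"
    using d(2)[of "d / 2"] by simp
  then show ?thesis
    using d(1) by (intro exI[of _ "d / 2"]) (simp only: V_exp, simp)
qed

theorem proposition2p2:
  fixes n t :: nat and p :: real and f :: "real \<Rightarrow> real"
  assumes "0 < n" and "0 < p" and "p < 1"
    and "0 < t" and "real n * p < real t" and "t < n"
    and "f \<in> F_sic"
    and "\<And>f'. f' \<in> F_sic \<Longrightarrow> V p n f (real t) \<le> V p n f' (real t)"
  shows "\<exists>g\<in>F_sic. V p n g (real t) = V p n f (real t) \<and>
           (\<exists>h>0. \<forall>x\<ge>0. g x = exp (h * x))"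
proof -
  have bound: "(1 - p + p * f 1) ^ n / f 1 ^ t \<le> V p n f (real t)"
    using assms by (intro V_lower_bound)
  have "f 1 \<noteq> 1"
  proof
    assume "f 1 = 1"
    with bound have "1 \<le> V p n f (real t)"
      by simp
    moreover obtain h where "0 < h" "V p n (\<lambda>x. exp (h * x)) (real t) < 1"
      using exists_exp_V_less_1 assms(5) by blast
    ultimately show False
      using assms(8)[OF exp_in_F_sic[of h]] by simp
  qed
  then have gt1: "1 < f 1"
    using F_sic_ge_1[OF assms(7), of 1] by simp
  define h where "h = ln (f 1)"
  have h: "0 < h" "exp h = f 1"
    using gt1 by (simp_all add: h_def)
  let ?g = "\<lambda>x. exp (h * x)"
  have g: "?g \<in> F_sic"
    using h by (simp add: exp_in_F_sic)
  have "V p n ?g (real t) \<le> V p n f (real t)"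
    using bound by (simp add: V_exp h)
  with assms(8)[OF g] have "V p n ?g (real t) = V p n f (real t)"
    by simp
  with g h(1) show ?thesis
    by blast
qed

end
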